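(* Let $m\ge1$ be an integer, and let a modulus of continuity $\omega$ and a number $n\in\mathbb{N}$, $n\ge 1$, be given. Consider recovery of the integral $\int_0^1f(x)\,dx$ (weight $P\equiv1$). Then $$R_n(H^\omega([0,1],K(\mathbb{R}^m)))=2n\int_0^{\frac1{2n}}\omega(t)\,dt,$$ an optimal set of knots is $$\overline{x}^*=(x_1^*,x_2^*,\dots,x_n^* )=\Bigl(\frac1{2n},\frac3{2n},\dots,\frac{2n-1}{2n}\Bigr),$$ and the method $$\Phi(f(x_1^* ),\dots,f(x_n^* ))=\mathrm{co}\Bigl(\frac1n\sum_{i=1}^nf\Bigl(\frac{2i-1}{2n}\Bigr)\Bigr)$$ is optimal on the class $H^\omega([0,1],K(\mathbb{R}^m))$ among all methods of recovery of the integral $\int_0^1f(x)\,dx$ that use information of the form $f(x_1),f(x_2),\dots,f(x_n)$ (for arbitrary sets of $n$ knots); that is, $R(H^\omega([0,1],K(\mathbb{R}^m)),\overline{x}^*,\Phi)=R(H^\omega([0,1],K(\mathbb{R}^m)),\overline{x}^* )=R_n(H^\omega([0,1],K(\mathbb{R}^m)))$.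
   Context: $K(\mathbb{R}^m)$ is the set of nonempty compact subsets of $\mathbb{R}^m$, and $K^c(\mathbb{R}^m)$ is the set of its convex elements. For $A,B\in K(\mathbb{R}^m)$ and $\lambda,\mu\in\mathbb{R}$, $\lambda A+\mu B=\{\lambda a+\mu b:a\in A,\,b\in B\}$ (Minkowski combination); $\mathrm{co}\,A$ is the convex hull of $A$. With $\|\cdot\|$ the Euclidean norm, $d(a,B)=\inf_{b\in B}\|a-b\|$ and $d(A,B)=\sup_{a\in A}d(a,B)$, the Hausdorff metric on $K(\mathbb{R}^m)$ is $\delta(A,B)=\max\{d(A,B),d(B,A)\}$. Riemann–Minkowski integral: for $g:[0,1]\to K(\mathbb{R}^m)$, a partition $0=t_0<t_1<\dots<t_N=1$ and tags $\xi_i\in[t_{i-1},t_i]$, the Riemann–Minkowski sum is $\sum_{i=1}^N(t_i-t_{i-1})g(\xi_i)$. The function $g$ is integrable, with integral $\int_0^1g(x)\,dx=I\in K(\mathbb{R}^m)$, if the Riemann–Minkowski sums converge to $I$ in the metric $\delta$ as the mesh $\max_i(t_i-t_{i-1})$ tends to $0$. Integrals of set-valued functions are understood in this sense; continuous bounded functions are integrable. A modulus of continuity is, as usual, a continuous nondecreasing subadditive function $\omega:[0,\infty)\to[0,\infty)$ with $\omega(0)=0$. $H^\omega([0,1],K(\mathbb{R}^m))$ is the class of functions $f:[0,1]\to K(\mathbb{R}^m)$ such that $\delta(f(x'),f(x''))\le\omega(|x'-x''|)$ for all $x',x''\in[0,1]$. For a set of knots $\overline{x}=\{x_1,\dots,x_n\}$,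 $0\le x_1<\dots<x_n\le1$, a method of recovery is an arbitrary mapping $\Phi:K(\mathbb{R}^m)^n\to K^c(\mathbb{R}^m)$. For a class $\mathcal{M}$ of integrable functions (and weight $P\equiv 1$), $$R(\mathcal{M},\overline{x},\Phi)=\sup_{f\in\mathcal{M}}\delta\Bigl(\int_0^1f(x)\,dx,\ \Phi(f(x_1),\dots,f(x_n))\Bigr),\qquad R(\mathcal{M},\overline{x})=\inf_{\Phi}R(\mathcal{M},\overline{x},\Phi),$$ $$R_n(\mathcal{M})=\inf_{\#(\overline{x})=n}R(\mathcal{M},\overline{x}),$$ where $\#(\overline{x})$ is the number of elements of $\overline{x}$. A set $\overline{x}^*$ realizing the last infimum is called an optimal set of knots. *)

theory Defs
  imports "HOL-Analysis.Analysis"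
begin

definition nonempty_compacts :: "'a::metric_space set set" where
  "nonempty_compacts = {A. compact A \<and> A \<noteq> {}}"

definition nonempty_compact_convex :: "'a::real_normed_vector set set" where
  "nonempty_compact_convex = {A \<in> nonempty_compacts. convex A}"

definition hausdorff_excess :: "'a::metric_space set \<Rightarrow> 'a set \<Rightarrow> real" where
  "hausdorff_excess A B = (SUP a\<in>A. infdist a B)"

definition hausdorff_dist :: "'a::metric_space set \<Rightarrow> 'a set \<Rightarrow> real" where
  "hausdorff_dist A B = max (hausdorff_excess A B) (hausdorff_excess B A)"

text \<open>
  A tagged partition consists of points \<open>0 = t 0 < \<dots> < t N = 1\<close> and tags
  \<open>\<xi> i\<close> in \<open>[t i, t (Suc i)]\<close> for \<open>i < N\<close>; values of \<open>t\<close> and \<open>\<xi>\<close> at other indices are irrelevant.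
\<close>

definition tagged_partition01 :: "nat \<Rightarrow> (nat \<Rightarrow> real) \<Rightarrow> (nat \<Rightarrow> real) \<Rightarrow> bool" where
  "tagged_partition01 N t \<xi> \<longleftrightarrow>
     t 0 = 0 \<and> t N = 1 \<and> (\<forall>i<N. t i < t (Suc i)) \<and> (\<forall>i<N. \<xi> i \<in> {t i..t (Suc i)})"

definition partition_mesh :: "nat \<Rightarrow> (nat \<Rightarrow> real) \<Rightarrow> real" where
  "partition_mesh N t = Max ((\<lambda>i. t (Suc i) - t i) ` {..<N})"

text \<open>The sum below is the Minkowski sum: addition of sets is the one of \<open>HOL-Library.Set_Algebras\<close>.\<close>

definition riemann_minkowski_sum ::
  "(real \<Rightarrow> 'a::real_normed_vector set) \<Rightarrow> nat \<Rightarrow> (nat \<Rightarrow> real) \<Rightarrow> (nat \<Rightarrow> real) \<Rightarrow> 'a set" where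
  "riemann_minkowski_sum g N t \<xi> = (\<Sum>i<N. (*\<^sub>R) (t (Suc i) - t i) ` g (\<xi> i))"

definition has_rm_integral :: "(real \<Rightarrow> 'a::real_normed_vector set) \<Rightarrow> 'a set \<Rightarrow> bool" where
  "has_rm_integral g I \<longleftrightarrow> I \<in> nonempty_compacts \<and>
     (\<forall>\<epsilon>>0. \<exists>\<delta>>0. \<forall>N t \<xi>. tagged_partition01 N t \<xi> \<and> partition_mesh N t < \<delta> \<longrightarrow>
        hausdorff_dist (riemann_minkowski_sum g N t \<xi>) I < \<epsilon>)"

definition rm_integral :: "(real \<Rightarrow> 'a::real_normed_vector set) \<Rightarrow> 'a set" where
  "rm_integral g = (THE I. has_rm_integral g I)"

definition modulus_of_continuity :: "(real \<Rightarrow> real) \<Rightarrow> bool" where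
  "modulus_of_continuity \<omega> \<longleftrightarrow>
     continuous_on {0..} \<omega> \<and> mono_on {0..} \<omega> \<and> (\<forall>t\<ge>0. 0 \<le> \<omega> t) \<and> \<omega> 0 = 0 \<and>
     (\<forall>s\<ge>0. \<forall>t\<ge>0. \<omega> (s + t) \<le> \<omega> s + \<omega> t)"

text \<open>Functions on \<open>[0,1]\<close> are total functions on the reals whose values outside \<open>[0,1]\<close> play no role.\<close>

definition H_class :: "(real \<Rightarrow> real) \<Rightarrow> (real \<Rightarrow> 'a::metric_space set) set" where
  "H_class \<omega> = {f. (\<forall>x\<in>{0..1}. f x \<in> nonempty_compacts) \<and>
     (\<forall>x\<in>{0..1}. \<forall>y\<in>{0..1}. hausdorff_dist (f x) (f y) \<le> \<omega> \<bar>x - y\<bar>)}"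

text \<open>
  A set of \<open>n\<close> knots is the strictly increasing list of its elements, and an element of
  the \<open>n\<close>-th power of \<open>nonempty_compacts\<close> is a list of length \<open>n\<close>.
\<close>

definition knot_lists :: "nat \<Rightarrow> real list set" where
  "knot_lists n = {xs. length xs = n \<and> sorted_wrt (<) xs \<and> set xs \<subseteq> {0..1}}"

definition recovery_methods :: "nat \<Rightarrow> ('a::real_normed_vector set list \<Rightarrow> 'a set) set" where
  "recovery_methods n =
     {As. length As = n \<and> set As \<subseteq> nonempty_compacts} \<rightarrow> nonempty_compact_convex"

text \<open>Errors are extended reals, since the error of an arbitrary method may be infinite.\<close>

definition method_error ::
  "(real \<Rightarrow> 'a::real_normed_vector set) set \<Rightarrow> real list \<Rightarrow> ('a set list \<Rightarrow> 'a set) \<Rightarrow> ereal" where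
  "method_error M xs \<Phi> = (SUP f\<in>M. ereal (hausdorff_dist (rm_integral f) (\<Phi> (map f xs))))"

definition knots_error :: "(real \<Rightarrow> 'a::real_normed_vector set) set \<Rightarrow> real list \<Rightarrow> ereal" where
  "knots_error M xs = (INF \<Phi>\<in>recovery_methods (length xs). method_error M xs \<Phi>)"

definition optimal_error :: "(real \<Rightarrow> 'a::real_normed_vector set) set \<Rightarrow> nat \<Rightarrow> ereal" where
  "optimal_error M n = (INF xs\<in>knot_lists n. knots_error M xs)"

definition midpoint_knots :: "nat \<Rightarrow> real list" where
  "midpoint_knots n = map (\<lambda>i. (2 * real i - 1) / (2 * real n)) [1..<n + 1]"

definition hull_mean :: "nat \<Rightarrow> 'a::real_normed_vector set list \<Rightarrow> 'a set" where
  "hull_mean n As = convex hull ((*\<^sub>R) (1 / real n) ` (\<Sum>i<n. As ! i))"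

end

theory Submission
  imports Defs
begin

text \<open>
  Convex compact sets are handled through their support functions
  \<open>h A u = (SUP a\<in>A. u \<bullet> a)\<close>: these are additive under Minkowski combinations with nonnegative
  coefficients, do not change when passing to the convex hull, and for convex compact sets the
  Hausdorff distance is controlled by the difference of support functions on the unit ball
  (\<open>hausdorff_dist_le_support_fun\<close>).

  \<^emph>\<open>The integral.\<close> For \<open>f\<close> in the class, the support functions of the Riemann--Minkowski sums are
  Riemann sums of the continuous functions \<open>x \<mapsto> h (f x) u\<close>, hence converge, uniformly for \<open>u\<close> in
  the unit ball, and the limit is the support function of a convex compact set \<open>I\<close>
  (\<open>support_fun_limit\<close>). The sums themselves need not be convex, but a Minkowski sum of many small sets
  is close to its convex hull (\<open>hausdorff_dist_sum_hull\<close>), so they converge to \<open>I\<close>. Thus the integral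
  exists, is convex, and its support function is \<open>u \<mapsto> \<integral> h (f x) u dx\<close>
  (\<open>H_class_rm_integral\<close>).

  \<^emph>\<open>Upper bound.\<close> In terms of support functions, the error of the hull of the mean over the midpoint
  knots is the error of the midpoint rule for the scalar function \<open>x \<mapsto> h (f x) u\<close>, whose modulus of
  continuity is at most \<open>\<omega>\<close>. On each of the \<open>n\<close> cells the error is at most
  \<open>2 * integral {0..1/(2n)} \<omega>\<close> (\<open>midpoint_rule_error\<close>).

  \<^emph>\<open>Lower bound.\<close> Given a set of knots \<open>K\<close> and a unit vector \<open>e\<close>, the two singleton-valued functions
  \<open>x \<mapsto> {\<plusminus> \<omega> (infdist x K) e}\<close> belong to the class and give the same information \<open>{0}, \<dots>, {0}\<close>.
  By the triangle inequality every method errs on one of them by at least half of the distance of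
  their integrals, that is, by \<open>\<integral> \<omega> (infdist x K) dx\<close>. This is at least
  \<open>2n * integral {0..1/(2n)} \<omega>\<close> for every \<open>K\<close> with at most \<open>n\<close> elements
  (\<open>integral_modulus_infdist_ge\<close>).
\<close>

section \<open>The Hausdorff distance of compact sets\<close>

text \<open>
  Infima over compact sets are attained, so the Hausdorff distance of nonempty compact sets can be
  treated through the existence of nearby points.
\<close>

lemma hausdorff_excess_le_iff:
  fixes A B :: "'a::metric_space set"
  assumes "A \<in> nonempty_compacts" "B \<in> nonempty_compacts"
  shows "hausdorff_excess A B \<le> e \<longleftrightarrow> (\<forall>a\<in>A. \<exists>b\<in>B. dist a b \<le> e)"
proof -
  have A: "compact A" "A \<noteq> {}" and B: "compact B" "B \<noteq> {}"
    using assms by (auto simp: nonempty_compacts_def)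
  have "compact ((\<lambda>a. infdist a B) ` A)"
    by (intro compact_continuous_image continuous_intros A)
  then have "bdd_above ((\<lambda>a. infdist a B) ` A)"
    by (intro bounded_imp_bdd_above compact_imp_bounded)
  then have "hausdorff_excess A B \<le> e \<longleftrightarrow> (\<forall>a\<in>A. infdist a B \<le> e)"
    unfolding hausdorff_excess_def using A by (simp add: cSUP_le_iff)
  moreover have "infdist a B \<le> e \<longleftrightarrow> (\<exists>b\<in>B. dist a b \<le> e)" for a
  proof
    assume le: "infdist a B \<le> e"
    obtain b where "b \<in> B" "\<And>c. c \<in> B \<Longrightarrow> dist a b \<le> dist a c"
      using continuous_attains_inf[OF B, of "dist a"] continuous_on_dist[OF continuous_on_const continuous_on_id]
      by blast
    moreover from this have "dist a b \<le> infdist a B"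
      using B(2) by (auto simp: infdist_def intro: cINF_greatest)
    ultimately show "\<exists>b\<in>B. dist a b \<le> e" using le by force
  qed (auto intro: infdist_le2)
  ultimately show ?thesis by simp
qed

lemma hausdorff_dist_le_iff:
  assumes "A \<in> nonempty_compacts" "B \<in> nonempty_compacts"
  shows "hausdorff_dist A B \<le> e \<longleftrightarrow>
    (\<forall>a\<in>A. \<exists>b\<in>B. dist a b \<le> e) \<and> (\<forall>b\<in>B. \<exists>a\<in>A. dist b a \<le> e)"
  using hausdorff_excess_le_iff[OF assms] hausdorff_excess_le_iff[OF assms(2,1)]
  by (simp add: hausdorff_dist_def)

lemma hausdorff_distD:
  assumes "A \<in> nonempty_compacts" "B \<in> nonempty_compacts" "a \<in> A"
  shows "\<exists>b\<in>B. dist a b \<le> hausdorff_dist A B"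
  using iffD1[OF hausdorff_dist_le_iff[OF assms(1,2)] order_refl] assms(3) by blast

lemma hausdorff_dist_commute: "hausdorff_dist A B = hausdorff_dist B A"
  by (simp add: hausdorff_dist_def max.commute)

lemma hausdorff_dist_triangle:
  assumes "A \<in> nonempty_compacts" "B \<in> nonempty_compacts" "C \<in> nonempty_compacts"
  shows "hausdorff_dist A C \<le> hausdorff_dist A B + hausdorff_dist B C"
proof -
  let ?p = "hausdorff_dist A B" and ?q = "hausdorff_dist B C"
  have AB: "\<And>a. a \<in> A \<Longrightarrow> \<exists>b\<in>B. dist a b \<le> ?p" "\<And>b. b \<in> B \<Longrightarrow> \<exists>a\<in>A. dist b a \<le> ?p"
    using hausdorff_distD[OF assms(1,2)] hausdorff_distD[OF assms(2,1)]
    by (simp_all add: hausdorff_dist_commute[of B A])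
  have BC: "\<And>b. b \<in> B \<Longrightarrow> \<exists>c\<in>C. dist b c \<le> ?q" "\<And>c. c \<in> C \<Longrightarrow> \<exists>b\<in>B. dist c b \<le> ?q"
    using hausdorff_distD[OF assms(2,3)] hausdorff_distD[OF assms(3,2)]
    by (simp_all add: hausdorff_dist_commute[of C B])
  have "\<exists>c\<in>C. dist a c \<le> ?p + ?q" if "a \<in> A" for a
  proof -
    obtain b where "b \<in> B" "dist a b \<le> ?p" using AB(1) \<open>a \<in> A\<close> by blast
    moreover obtain c where "c \<in> C" "dist b c \<le> ?q" using BC(1) \<open>b \<in> B\<close> by blast
    ultimately show ?thesis using dist_triangle[of a c b] by (intro bexI[of _ c]) auto
  qed
  moreover have "\<exists>a\<in>A. dist c a \<le> ?p + ?q" if "c \<in> C" for c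
  proof -
    obtain b where "b \<in> B" "dist c b \<le> ?q" using BC(2) \<open>c \<in> C\<close> by blast
    moreover obtain a where "a \<in> A" "dist b a \<le> ?p" using AB(2) \<open>b \<in> B\<close> by blast
    ultimately show ?thesis using dist_triangle[of c a b] by (intro bexI[of _ a]) auto
  qed
  ultimately show ?thesis
    using hausdorff_dist_le_iff[OF assms(1,3)] by simp
qed

lemma hausdorff_dist_nonneg:
  assumes "A \<in> nonempty_compacts" "B \<in> nonempty_compacts"
  shows "0 \<le> hausdorff_dist A B"
proof -
  obtain a where "a \<in> A" using assms by (auto simp: nonempty_compacts_def)
  then obtain b where "dist a b \<le> hausdorff_dist A B"
    using hausdorff_distD[OF assms] by blast
  then show ?thesis using zero_le_dist[of a b] by linarith
qed

lemma hausdorff_dist_eq_0_imp_eq: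
  assumes "A \<in> nonempty_compacts" "B \<in> nonempty_compacts" "hausdorff_dist A B = 0"
  shows "A = B"
  using hausdorff_dist_le_iff[OF assms(1,2), of 0] assms(3) by auto

lemma hausdorff_dist_singletons: "hausdorff_dist {a} {b} = dist a b"
  by (simp add: hausdorff_dist_def hausdorff_excess_def infdist_def dist_commute)

section \<open>Minkowski combinations and support functions\<close>

lemma nonempty_compacts_scaleR:
  fixes A :: "'a::real_normed_vector set"
  shows
  "A \<in> nonempty_compacts \<Longrightarrow> (*\<^sub>R) c ` A \<in> nonempty_compacts"
  using compact_scaling[of A c] by (simp add: nonempty_compacts_def)

lemma nonempty_compacts_plus:
  fixes A B :: "'a::real_normed_vector set"
  assumes "A \<in> nonempty_compacts" "B \<in> nonempty_compacts"
  shows "A + B \<in> nonempty_compacts"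
proof -
  have "A + B = {x + y |x y. x \<in> A \<and> y \<in> B}" by (auto simp: set_plus_def)
  with assms compact_sums[of A B] show ?thesis by (auto simp: nonempty_compacts_def)
qed

lemma nonempty_compacts_sum:
  fixes A :: "'i \<Rightarrow> 'a::real_normed_vector set"
  assumes "\<And>i. i \<in> K \<Longrightarrow> A i \<in> nonempty_compacts"
  shows "(\<Sum>i\<in>K. A i) \<in> nonempty_compacts"
  using assms
proof (induction K rule: infinite_finite_induct)
  case (insert x F)
  then show ?case by (simp add: nonempty_compacts_plus)
qed (auto simp: nonempty_compacts_def set_zero)

lemma nonempty_compacts_hull:
  fixes A :: "'a::euclidean_space set"
  shows "A \<in> nonempty_compacts \<Longrightarrow> convex hull A \<in> nonempty_compacts"
  by (simp add: nonempty_compacts_def compact_convex_hull)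

text \<open>
  The support function. Being a supremum of reals, it is meaningful for sets that are nonempty and
  bounded; for \<open>A \<in> nonempty_compacts\<close> it is attained.
\<close>

definition support_fun :: "'a::euclidean_space set \<Rightarrow> 'a \<Rightarrow> real" where
  "support_fun A u = (SUP a\<in>A. u \<bullet> a)"

lemma support_fun_attained:
  assumes "A \<in> nonempty_compacts"
  obtains a where "a \<in> A" "support_fun A u = u \<bullet> a" "\<And>b. b \<in> A \<Longrightarrow> u \<bullet> b \<le> u \<bullet> a"
proof -
  have "\<exists>a\<in>A. \<forall>b\<in>A. u \<bullet> b \<le> u \<bullet> a"
    using assms by (intro continuous_attains_sup continuous_intros)
      (auto simp: nonempty_compacts_def)
  then obtain a where a: "a \<in> A" "\<And>b. b \<in> A \<Longrightarrow> u \<bullet> b \<le> u \<bullet> a" by blast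
  then have "support_fun A u = u \<bullet> a"
    unfolding support_fun_def by (intro cSup_eq_maximum) auto
  with a show ?thesis using that by blast
qed

lemma support_fun_upper:
  assumes "A \<in> nonempty_compacts" "a \<in> A"
  shows "u \<bullet> a \<le> support_fun A u"
  using support_fun_attained[OF assms(1), of u] assms(2) by metis

lemma support_fun_eqI:
  assumes "a \<in> A" "u \<bullet> a = s" "\<And>b. b \<in> A \<Longrightarrow> u \<bullet> b \<le> s"
  shows "support_fun A u = s"
  unfolding support_fun_def using assms by (intro cSup_eq_maximum) auto

lemma support_fun_hull:
  assumes "A \<in> nonempty_compacts"
  shows "support_fun (convex hull A) u = support_fun A u"
proof -
  obtain a where a: "a \<in> A" "support_fun A u = u \<bullet> a" "\<And>b. b \<in> A \<Longrightarrow> u \<bullet> b \<le> u \<bullet> a"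
    using support_fun_attained[OF assms] by blast
  have "convex hull A \<subseteq> {b. u \<bullet> b \<le> u \<bullet> a}"
    using a(3) by (intro hull_minimal convex_halfspace_le) auto
  with a(1,2) show ?thesis
    by (intro support_fun_eqI[of a]) (auto simp: hull_inc)
qed

lemma support_fun_plus:
  assumes "A \<in> nonempty_compacts" "B \<in> nonempty_compacts"
  shows "support_fun (A + B) u = support_fun A u + support_fun B u"
proof -
  obtain a where a: "a \<in> A" "support_fun A u = u \<bullet> a" "\<And>b. b \<in> A \<Longrightarrow> u \<bullet> b \<le> u \<bullet> a"
    using support_fun_attained[OF assms(1)] by blast
  obtain b where b: "b \<in> B" "support_fun B u = u \<bullet> b" "\<And>c. c \<in> B \<Longrightarrow> u \<bullet> c \<le> u \<bullet> b"
    using support_fun_attained[OF assms(2)] by blast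
  show ?thesis
  proof (rule support_fun_eqI)
    show "u \<bullet> c \<le> support_fun A u + support_fun B u" if "c \<in> A + B" for c
      using that a(2,3) b(2,3) by (force simp: inner_add_right elim!: set_plus_elim intro: add_mono)
  qed (use a b in \<open>auto simp: inner_add_right\<close>)
qed

lemma support_fun_scaleR:
  assumes "A \<in> nonempty_compacts" "0 \<le> c"
  shows "support_fun ((*\<^sub>R) c ` A) u = c * support_fun A u"
proof -
  obtain a where a: "a \<in> A" "support_fun A u = u \<bullet> a" "\<And>b. b \<in> A \<Longrightarrow> u \<bullet> b \<le> u \<bullet> a"
    using support_fun_attained[OF assms(1)] by blast
  show ?thesis
    using a assms(2) by (intro support_fun_eqI[of "c *\<^sub>R a"]) (auto intro!: mult_left_mono)
qed

lemma support_fun_sum: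
  assumes "finite K" "\<And>i. i \<in> K \<Longrightarrow> A i \<in> nonempty_compacts"
  shows "support_fun (\<Sum>i\<in>K. A i) u = (\<Sum>i\<in>K. support_fun (A i) u)"
  using assms
proof (induction K rule: finite_induct)
  case empty
  then show ?case by (simp add: support_fun_def set_zero)
next
  case (insert x F)
  then show ?case by (simp add: support_fun_plus nonempty_compacts_sum)
qed

lemma support_fun_le_hausdorff:
  assumes "A \<in> nonempty_compacts" "B \<in> nonempty_compacts" "norm u \<le> 1"
  shows "support_fun A u \<le> support_fun B u + hausdorff_dist A B"
proof -
  obtain a where a: "a \<in> A" "support_fun A u = u \<bullet> a"
    using support_fun_attained[OF assms(1)] by blast
  obtain b where b: "b \<in> B" "dist a b \<le> hausdorff_dist A B"
    using hausdorff_distD[OF assms(1,2) a(1)] by blast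
  have "u \<bullet> a = u \<bullet> b + u \<bullet> (a - b)" by (simp add: inner_diff_right)
  moreover have "u \<bullet> (a - b) \<le> norm u * norm (a - b)" by (rule norm_cauchy_schwarz)
  moreover have "\<dots> \<le> 1 * norm (a - b)" using assms(3) by (intro mult_right_mono) auto
  ultimately show ?thesis
    using support_fun_upper[OF assms(2) b(1), of u] a b by (simp add: dist_norm)
qed

lemma abs_support_fun_diff_le:
  assumes "A \<in> nonempty_compacts" "B \<in> nonempty_compacts" "norm u \<le> 1"
  shows "\<bar>support_fun A u - support_fun B u\<bar> \<le> hausdorff_dist A B"
  using support_fun_le_hausdorff[OF assms] support_fun_le_hausdorff[OF assms(2,1,3)]
  by (simp add: hausdorff_dist_commute[of B A])

text \<open>
  The separation argument: if \<open>b\<close> is the point of \<open>B\<close> closest to \<open>a\<close>, then the unit vector in the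
  direction \<open>a - b\<close> attains its maximum over \<open>B\<close> at \<open>b\<close>.
\<close>

lemma support_fun_le_imp_close:
  fixes A B :: "'a::euclidean_space set"
  assumes A: "A \<in> nonempty_compacts" and B: "B \<in> nonempty_compacts" "convex B"
    and le: "\<And>u. norm u \<le> 1 \<Longrightarrow> support_fun A u \<le> support_fun B u + e" and "0 \<le> e"
    and a: "a \<in> A"
  shows "\<exists>b\<in>B. dist a b \<le> e"
proof -
  have clB: "closed B" "B \<noteq> {}"
    using B by (auto simp: nonempty_compacts_def compact_imp_closed)
  define b where "b = closest_point B a"
  have bB: "b \<in> B" unfolding b_def using clB by (rule closest_point_in_set)
  have "dist a b \<le> e"
  proof (cases "a = b")
    case False
    define u where "u = (a - b) /\<^sub>R norm (a - b)"
    have nu: "norm u = 1" using False by (simp add: u_def)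
    have "u \<bullet> c \<le> u \<bullet> b" if "c \<in> B" for c
      using closest_point_dot[OF B(2) clB(1) that, of a]
      by (auto simp: u_def b_def[symmetric] inner_diff_right intro!: mult_left_mono)
    then have "support_fun B u = u \<bullet> b" using bB by (intro support_fun_eqI) auto
    then have "u \<bullet> a \<le> u \<bullet> b + e"
      using support_fun_upper[OF A a, of u] le[of u] nu by simp
    moreover have "u \<bullet> (a - b) = norm (a - b)"
      using False by (simp add: u_def power2_norm_eq_inner[symmetric] power2_eq_square)
    ultimately show ?thesis by (simp add: inner_diff_right dist_norm)
  qed (use \<open>0 \<le> e\<close> in simp)
  with bB show ?thesis by blast
qed

lemma hausdorff_dist_le_support_fun:
  fixes A B :: "'a::euclidean_space set"
  assumes A: "A \<in> nonempty_compact_convex" and B: "B \<in> nonempty_compact_convex"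
    and le: "\<And>u. norm u \<le> 1 \<Longrightarrow> \<bar>support_fun A u - support_fun B u\<bar> \<le> e"
  shows "hausdorff_dist A B \<le> e"
proof -
  have A': "A \<in> nonempty_compacts" "convex A" and B': "B \<in> nonempty_compacts" "convex B"
    using A B by (auto simp: nonempty_compact_convex_def)
  have "0 \<le> e" using le[of 0] by simp
  have "\<And>u. norm u \<le> 1 \<Longrightarrow> support_fun A u \<le> support_fun B u + e"
    "\<And>u. norm u \<le> 1 \<Longrightarrow> support_fun B u \<le> support_fun A u + e"
    using le by (fastforce simp: abs_le_iff)+
  then show ?thesis
    unfolding hausdorff_dist_le_iff[OF A'(1) B'(1)]
    using support_fun_le_imp_close[OF A'(1) B' _ \<open>0 \<le> e\<close>]
      support_fun_le_imp_close[OF B'(1) A' _ \<open>0 \<le> e\<close>] by blast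
qed

section \<open>Minkowski sums of many small sets are nearly convex\<close>

text \<open>
  A dimension-free form of the Shapley--Folkman theorem: a point of the sum of the convex hulls
  is approximated by a point of the sum of the sets themselves, with a squared error at
  most the sum of the squares of the diameters of the balls of radius \<open>r i\<close> containing the sets.
\<close>

lemma minkowski_sum_near_hull:
  fixes A :: "nat \<Rightarrow> 'a::euclidean_space set"
  assumes "\<And>i a. i < N \<Longrightarrow> a \<in> A i \<Longrightarrow> norm a \<le> r i"
    and "x \<in> (\<Sum>i<N. convex hull (A i))"
  shows "\<exists>a\<in>(\<Sum>i<N. A i). (norm (x - a))\<^sup>2 \<le> (\<Sum>i<N. (2 * r i)\<^sup>2)"
  using assms
proof (induction N arbitrary: x)
  case 0
  then show ?case by (simp add: set_zero)
next
  case (Suc N)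
  from Suc.prems(2) obtain y z where x: "x = y + z"
    and y: "y \<in> (\<Sum>i<N. convex hull (A i))" and z: "z \<in> convex hull (A N)"
    by (auto elim: set_plus_elim)
  have "\<And>i a. i < N \<Longrightarrow> a \<in> A i \<Longrightarrow> norm a \<le> r i"
    using Suc.prems(1) less_SucI by blast
  then obtain b where b: "b \<in> (\<Sum>i<N. A i)" "(norm (y - b))\<^sup>2 \<le> (\<Sum>i<N. (2 * r i)\<^sup>2)"
    using Suc.IH[OF _ y] by blast
  \<comment> \<open>Since \<open>z\<close> is an average of points of \<open>A N\<close>, some point \<open>c\<close> makes \<open>z - c\<close> point
    away from the error \<open>y - b\<close> made so far, so that squared errors add up at most.\<close>
  obtain c where c: "c \<in> A N" "(y - b) \<bullet> z \<le> (y - b) \<bullet> c"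
  proof (rule ccontr)
    assume "\<not> thesis"
    then have "A N \<subseteq> {c. (y - b) \<bullet> c < (y - b) \<bullet> z}" using that by fastforce
    then have "convex hull (A N) \<subseteq> {c. (y - b) \<bullet> c < (y - b) \<bullet> z}"
      by (intro hull_minimal convex_halfspace_lt)
    with z show False by auto
  qed
  have "A N \<subseteq> cball 0 (r N)" using Suc.prems(1)[of N] by auto
  then have "convex hull (A N) \<subseteq> cball 0 (r N)" by (intro hull_minimal) auto
  with z have "norm z \<le> r N" by auto
  moreover have "norm c \<le> r N" using c(1) Suc.prems(1) by blast
  ultimately have "norm (z - c) \<le> 2 * r N" using norm_triangle_ineq4[of z c] by simp
  then have zc: "(norm (z - c))\<^sup>2 \<le> (2 * r N)\<^sup>2" by (intro power_mono) auto
  have sum_eq: "x - (b + c) = (y - b) + (z - c)" by (simp add: x)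
  have "(norm (x - (b + c)))\<^sup>2 =
      (norm (y - b))\<^sup>2 + (norm (z - c))\<^sup>2 + 2 * ((y - b) \<bullet> (z - c))"
    unfolding sum_eq by (simp add: dot_norm field_simps)
  also have "\<dots> \<le> (\<Sum>i<N. (2 * r i)\<^sup>2) + (2 * r N)\<^sup>2"
    using b(2) zc c(2) by (simp add: inner_diff_right)
  finally have "(norm (x - (b + c)))\<^sup>2 \<le> (\<Sum>i<Suc N. (2 * r i)\<^sup>2)" by simp
  moreover have "b + c \<in> (\<Sum>i<Suc N. A i)" using b(1) c(1) by auto
  ultimately show ?case by blast
qed

lemma hausdorff_dist_sum_hull:
  fixes A :: "nat \<Rightarrow> 'a::euclidean_space set"
  assumes A: "\<And>i. i < N \<Longrightarrow> A i \<in> nonempty_compacts"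
    and r: "\<And>i a. i < N \<Longrightarrow> a \<in> A i \<Longrightarrow> norm a \<le> r i"
  shows "hausdorff_dist (\<Sum>i<N. A i) (convex hull (\<Sum>i<N. A i)) \<le> sqrt (\<Sum>i<N. (2 * r i)\<^sup>2)"
proof -
  have S: "(\<Sum>i<N. A i) \<in> nonempty_compacts" using A by (intro nonempty_compacts_sum) auto
  have "\<exists>b\<in>convex hull (\<Sum>i<N. A i). dist a b \<le> sqrt (\<Sum>i<N. (2 * r i)\<^sup>2)"
    if "a \<in> (\<Sum>i<N. A i)" for a
    using that by (intro bexI[of _ a]) (auto simp: hull_inc sum_nonneg)
  moreover have "\<exists>a\<in>(\<Sum>i<N. A i). dist x a \<le> sqrt (\<Sum>i<N. (2 * r i)\<^sup>2)"
    if "x \<in> convex hull (\<Sum>i<N. A i)" for x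
    using minkowski_sum_near_hull[of N A r x] r that
    by (force simp: convex_hull_set_sum dist_norm intro: real_le_rsqrt)
  ultimately show ?thesis
    by (simp add: hausdorff_dist_le_iff[OF S nonempty_compacts_hull[OF S]])
qed

section \<open>Partitions and Riemann sums\<close>

text \<open>
  The inequality \<open>t 0 \<le> t N\<close> is part of the conclusion because the induction needs it.
\<close>

lemma integral_partition:
  fixes \<phi> :: "real \<Rightarrow> real"
  assumes "\<And>i. i < N \<Longrightarrow> t i \<le> t (Suc i)" and "continuous_on {t 0..t N} \<phi>"
  shows "integral {t 0..t N} \<phi> = (\<Sum>i<N. integral {t i..t (Suc i)} \<phi>) \<and> t 0 \<le> t N"
  using assms
proof (induction N)
  case 0
  then show ?case by simp
next
  case (Suc N)
  have le: "t N \<le> t (Suc N)" using Suc.prems(1) by simp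
  then have "continuous_on {t 0..t N} \<phi>"
    using Suc.prems(2) by (elim continuous_on_subset) auto
  with Suc have IH: "integral {t 0..t N} \<phi> = (\<Sum>i<N. integral {t i..t (Suc i)} \<phi>)" "t 0 \<le> t N"
    by simp_all
  have "integral {t 0..t N} \<phi> + integral {t N..t (Suc N)} \<phi> = integral {t 0..t (Suc N)} \<phi>"
    by (intro Henstock_Kurzweil_Integration.integral_combine IH le integrable_continuous_real Suc.prems(2))
  with IH le show ?case by simp
qed

lemma partition_le:
  fixes t :: "nat \<Rightarrow> real"
  assumes "\<And>i. i < N \<Longrightarrow> t i \<le> t (Suc i)" "i \<le> j" "j \<le> N"
  shows "t i \<le> t j"
  using assms(2,3)
proof (induction j rule: dec_induct)
  case (step k)
  then show ?case using assms(1)[of k] by force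
qed simp

lemma tagged_partition01D:
  assumes "tagged_partition01 N t \<xi>" "i < N"
  shows "0 \<le> t i" "t i < t (Suc i)" "t (Suc i) \<le> 1" "\<xi> i \<in> {t i..t (Suc i)}" "\<xi> i \<in> {0..1}"
    and "t (Suc i) - t i \<le> partition_mesh N t"
proof -
  have t: "t 0 = 0" "t N = 1" "\<And>i. i < N \<Longrightarrow> t i < t (Suc i)" "\<xi> i \<in> {t i..t (Suc i)}"
    using assms by (auto simp: tagged_partition01_def)
  show *: "0 \<le> t i" "t i < t (Suc i)" "t (Suc i) \<le> 1" "\<xi> i \<in> {t i..t (Suc i)}"
    using partition_le[of N t 0 i] partition_le[of N t "Suc i" N] t assms(2)
    by (auto simp: less_imp_le)
  then show "\<xi> i \<in> {0..1}" by auto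
  show "t (Suc i) - t i \<le> partition_mesh N t"
    using assms(2) by (auto simp: partition_mesh_def)
qed

lemma tagged_partition01_sum:
  "tagged_partition01 N t \<xi> \<Longrightarrow> (\<Sum>i<N. t (Suc i) - t i) = 1"
  by (simp add: sum_lessThan_telescope tagged_partition01_def)

lemma tagged_partition01_pos: "tagged_partition01 N t \<xi> \<Longrightarrow> 0 < N"
  by (cases N) (auto simp: tagged_partition01_def)

lemma partition_mesh_pos: "tagged_partition01 N t \<xi> \<Longrightarrow> 0 < partition_mesh N t"
  using tagged_partition01D(2,6)[of N t \<xi> 0] tagged_partition01_pos by fastforce

lemma uniform_partition:
  assumes "0 < N"
  shows "tagged_partition01 N (\<lambda>i. real i / real N) (\<lambda>i. real i / real N)"
    and "partition_mesh N (\<lambda>i. real i / real N) = 1 / real N"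
proof -
  show "tagged_partition01 N (\<lambda>i. real i / real N) (\<lambda>i. real i / real N)"
    using assms by (auto simp: tagged_partition01_def divide_simps)
  have "(\<lambda>i. real (Suc i) / real N - real i / real N) ` {..<N} = {1 / real N}"
    using assms by (auto simp: image_iff diff_divide_distrib[symmetric])
  then show "partition_mesh N (\<lambda>i. real i / real N) = 1 / real N"
    by (simp add: partition_mesh_def)
qed

lemma riemann_sum_error:
  fixes \<phi> :: "real \<Rightarrow> real"
  assumes P: "tagged_partition01 N t \<xi>" and \<phi>: "continuous_on {0..1} \<phi>"
    and close: "\<And>x y. x \<in> {0..1} \<Longrightarrow> y \<in> {0..1} \<Longrightarrow> \<bar>x - y\<bar> \<le> partition_mesh N t \<Longrightarrow> \<bar>\<phi> x - \<phi> y\<bar> \<le> e"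
  shows "\<bar>(\<Sum>i<N. (t (Suc i) - t i) * \<phi> (\<xi> i)) - integral {0..1} \<phi>\<bar> \<le> e"
proof -
  have t: "t 0 = 0" "t N = 1" using P by (auto simp: tagged_partition01_def)
  have le: "t i \<le> t (Suc i)" if "i < N" for i
    using tagged_partition01D(2)[OF P that] by simp
  have int: "integral {0..1} \<phi> = (\<Sum>i<N. integral {t i..t (Suc i)} \<phi>)"
    using integral_partition[of N t \<phi>] le \<phi> t by simp
  have cell: "\<bar>(t (Suc i) - t i) * \<phi> (\<xi> i) - integral {t i..t (Suc i)} \<phi>\<bar> \<le> e * (t (Suc i) - t i)"
    if i: "i < N" for i
  proof -
    note ti = tagged_partition01D[OF P i]
    have sub: "{t i..t (Suc i)} \<subseteq> {0..1}" using ti by auto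
    have cont: "continuous_on {t i..t (Suc i)} \<phi>" using \<phi> sub by (rule continuous_on_subset)
    have "(t (Suc i) - t i) * \<phi> (\<xi> i) - integral {t i..t (Suc i)} \<phi> =
        integral {t i..t (Suc i)} (\<lambda>x. \<phi> (\<xi> i) - \<phi> x)"
      using ti(2) cont by (subst integral_diff) (auto intro: integrable_continuous_real)
    moreover have "norm (integral {t i..t (Suc i)} (\<lambda>x. \<phi> (\<xi> i) - \<phi> x)) \<le> e * (t (Suc i) - t i)"
    proof (rule integral_bound)
      show "continuous_on {t i..t (Suc i)} (\<lambda>x. \<phi> (\<xi> i) - \<phi> x)"
        by (intro continuous_intros cont)
      show "norm (\<phi> (\<xi> i) - \<phi> x) \<le> e" if "x \<in> {t i..t (Suc i)}" for x
        using close[of "\<xi> i" x] that ti sub by force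
    qed (use ti(2) in simp)
    ultimately show ?thesis by simp
  qed
  have "\<bar>(\<Sum>i<N. (t (Suc i) - t i) * \<phi> (\<xi> i)) - integral {0..1} \<phi>\<bar> =
      \<bar>\<Sum>i<N. (t (Suc i) - t i) * \<phi> (\<xi> i) - integral {t i..t (Suc i)} \<phi>\<bar>"
    by (simp add: int sum_subtractf)
  also have "\<dots> \<le> (\<Sum>i<N. e * (t (Suc i) - t i))"
    using cell by (intro order_trans[OF sum_abs] sum_mono) auto
  also have "\<dots> = e"
    by (simp add: sum_distrib_left[symmetric] tagged_partition01_sum[OF P])
  finally show ?thesis .
qed

section \<open>Moduli of continuity\<close>

lemma modulus_of_continuityD:
  assumes "modulus_of_continuity \<omega>"
  shows "continuous_on {0..} \<omega>" "\<And>s t. 0 \<le> s \<Longrightarrow> s \<le> t \<Longrightarrow> \<omega> s \<le> \<omega> t"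
    "\<And>t. 0 \<le> t \<Longrightarrow> 0 \<le> \<omega> t" "\<omega> 0 = 0"
    "\<And>s t. 0 \<le> s \<Longrightarrow> 0 \<le> t \<Longrightarrow> \<omega> (s + t) \<le> \<omega> s + \<omega> t"
  using assms by (auto simp: modulus_of_continuity_def mono_on_def)

lemma modulus_of_continuity_tendsto_0:
  assumes "modulus_of_continuity \<omega>" "0 < e"
  shows "\<exists>d>0. \<forall>s. 0 \<le> s \<longrightarrow> s < d \<longrightarrow> \<omega> s < e"
proof -
  have "continuous (at 0 within {0..}) \<omega>"
    using modulus_of_continuityD(1)[OF assms(1)] by (simp add: continuous_on_eq_continuous_within)
  then show ?thesis
    using assms(2) modulus_of_continuityD(4)[OF assms(1)]
    unfolding continuous_within_eps_delta
    by (fastforce simp: dist_real_def)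
qed

lemma modulus_bounded_imp_continuous:
  fixes \<phi> :: "real \<Rightarrow> real"
  assumes \<omega>: "modulus_of_continuity \<omega>"
    and \<phi>: "\<And>x y. x \<in> S \<Longrightarrow> y \<in> S \<Longrightarrow> \<bar>\<phi> x - \<phi> y\<bar> \<le> \<omega> \<bar>x - y\<bar>"
  shows "continuous_on S \<phi>"
  unfolding continuous_on_iff
proof (intro ballI allI impI)
  fix x and e :: real assume x: "x \<in> S" and "0 < e"
  then obtain d where d: "0 < d" "\<And>s. 0 \<le> s \<Longrightarrow> s < d \<Longrightarrow> \<omega> s < e"
    using modulus_of_continuity_tendsto_0[OF \<omega>] by blast
  have "dist (\<phi> y) (\<phi> x) < e" if "y \<in> S" "dist y x < d" for y
    using \<phi>[OF that(1) x] d(2)[of "\<bar>y - x\<bar>"] that(2) by (simp add: dist_real_def)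
  with d(1) show "\<exists>d>0. \<forall>y\<in>S. dist y x < d \<longrightarrow> dist (\<phi> y) (\<phi> x) < e" by blast
qed

lemma modulus_abs_diff:
  assumes \<omega>: "modulus_of_continuity \<omega>" and "0 \<le> s" "0 \<le> t" "\<bar>s - t\<bar> \<le> r"
  shows "\<bar>\<omega> s - \<omega> t\<bar> \<le> \<omega> r"
proof -
  have "\<omega> a \<le> \<omega> b + \<omega> r" if "0 \<le> a" "0 \<le> b" "\<bar>a - b\<bar> \<le> r" for a b
  proof -
    have "\<omega> a \<le> \<omega> (b + r)" using that by (intro modulus_of_continuityD(2)[OF \<omega>]) auto
    also have "\<dots> \<le> \<omega> b + \<omega> r" using that by (intro modulus_of_continuityD(5)[OF \<omega>]) auto
    finally show ?thesis .
  qed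
  from this[of s t] this[of t s] assms(2-) show ?thesis by (simp add: abs_minus_commute abs_le_iff)
qed

section \<open>The midpoint rule and the extremal integral\<close>

lemma integral_abs_shift:
  fixes g :: "real \<Rightarrow> real"
  assumes g: "continuous_on {0..} g" and "a \<le> m" "m \<le> b"
  shows "integral {a..b} (\<lambda>x. g \<bar>x - m\<bar>) = integral {0..m - a} g + integral {0..b - m} g"
proof -
  have "continuous_on {a..b} (\<lambda>x. g \<bar>x - m\<bar>)"
    by (intro continuous_on_compose2[OF g] continuous_intros) auto
  then have "integral {a..b} (\<lambda>x. g \<bar>x - m\<bar>) =
      integral {a..m} (\<lambda>x. g \<bar>x - m\<bar>) + integral {m..b} (\<lambda>x. g \<bar>x - m\<bar>)"
    by (intro Henstock_Kurzweil_Integration.integral_combine[symmetric] assms integrable_continuous_real)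
  moreover have "integral {a..m} (\<lambda>x. g \<bar>x - m\<bar>) = integral {0..m - a} g"
  proof -
    have "integral {a..m} (\<lambda>x. g \<bar>x - m\<bar>) = integral {- (- a).. - (- m)} (\<lambda>x. g (- x + m))"
      by (auto intro!: integral_cong)
    also have "\<dots> = integral {- m.. - a} (\<lambda>y. g (y + m))"
      by (rule Henstock_Kurzweil_Integration.integral_reflect_real[of "- a" "- m" "\<lambda>y. g (y + m)"])
    also have "\<dots> = integral {0..m - a} g"
      using integral_shift_real_ivl[of 0 m "m - a" g] by simp
    finally show ?thesis .
  qed
  moreover have "integral {m..b} (\<lambda>x. g \<bar>x - m\<bar>) = integral {0..b - m} g"
  proof -
    have "integral {m..b} (\<lambda>x. g \<bar>x - m\<bar>) = integral {m..b} (\<lambda>x. g (x + (- m)))"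
      by (auto intro!: integral_cong)
    also have "\<dots> = integral {0..b - m} g"
      using integral_shift_real_ivl[of 0 "- m" "b - m" g] by simp
    finally show ?thesis .
  qed
  ultimately show ?thesis by simp
qed

lemma midpoint_rule_error:
  fixes \<phi> :: "real \<Rightarrow> real"
  assumes \<omega>: "modulus_of_continuity \<omega>" and n: "0 < n"
    and \<phi>: "\<And>x y. x \<in> {0..1} \<Longrightarrow> y \<in> {0..1} \<Longrightarrow> \<bar>\<phi> x - \<phi> y\<bar> \<le> \<omega> \<bar>x - y\<bar>"
  shows "\<bar>integral {0..1} \<phi> - (\<Sum>i<n. \<phi> ((2 * real i + 1) / (2 * real n))) / real n\<bar>
    \<le> 2 * real n * integral {0..1 / (2 * real n)} \<omega>"
proof -
  define c where "c = 1 / (2 * real n)"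
  define m where "m i = (2 * real i + 1) / (2 * real n)" for i
  define t where "t i = real i / real n" for i :: nat
  have cont: "continuous_on {0..1} \<phi>" using \<omega> \<phi> by (rule modulus_bounded_imp_continuous)
  have t: "t 0 = 0" "t n = 1" "t i \<le> t (Suc i)" for i using n by (auto simp: t_def divide_simps)
  have tm: "t i = m i - c" "t (Suc i) = m i + c" "t (Suc i) - t i = 1 / real n" for i
    using n by (auto simp: t_def m_def c_def field_simps)
  have c: "0 < c" using n by (simp add: c_def)
  have cell: "\<bar>integral {t i..t (Suc i)} \<phi> - \<phi> (m i) / real n\<bar> \<le> 2 * integral {0..c} \<omega>"
    if i: "i < n" for i
  proof -
    have sub: "{t i..t (Suc i)} \<subseteq> {0..1}" using n i by (auto simp: t_def divide_simps)
    have mi: "m i \<in> {t i..t (Suc i)}" unfolding tm(2) unfolding tm(1) using c by simp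
    have cont_i: "continuous_on {t i..t (Suc i)} \<phi>" using cont sub by (rule continuous_on_subset)
    have "integral {t i..t (Suc i)} \<phi> - \<phi> (m i) / real n =
        integral {t i..t (Suc i)} (\<lambda>x. \<phi> x - \<phi> (m i))"
      using cont_i t(3)[of i] tm(3)[of i]
      by (subst integral_diff) (auto intro: integrable_continuous_real)
    also have "\<bar>\<dots>\<bar> \<le> integral {t i..t (Suc i)} (\<lambda>x. \<omega> \<bar>x - m i\<bar>)"
    proof -
      have "norm (\<phi> x - \<phi> (m i)) \<le> \<omega> \<bar>x - m i\<bar>" if "x \<in> {t i..t (Suc i)}" for x
        using \<phi>[of x "m i"] that mi sub by auto
      moreover have "(\<lambda>x. \<phi> x - \<phi> (m i)) integrable_on {t i..t (Suc i)}"
        by (intro integrable_continuous_real continuous_intros cont_i)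
      moreover have "(\<lambda>x. \<omega> \<bar>x - m i\<bar>) integrable_on {t i..t (Suc i)}"
        by (intro integrable_continuous_real continuous_intros
          continuous_on_compose2[OF modulus_of_continuityD(1)[OF \<omega>]]) auto
      ultimately show ?thesis
        unfolding real_norm_def[symmetric] by (intro integral_norm_bound_integral)
    qed
    also have "\<dots> = 2 * integral {0..c} \<omega>"
      unfolding tm(2) unfolding tm(1) using c
      by (subst integral_abs_shift[OF modulus_of_continuityD(1)[OF \<omega>]]) auto
    finally show ?thesis .
  qed
  have "integral {0..1} \<phi> = (\<Sum>i<n. integral {t i..t (Suc i)} \<phi>)"
    using integral_partition[of n t \<phi>] t cont by simp
  then have "\<bar>integral {0..1} \<phi> - (\<Sum>i<n. \<phi> (m i)) / real n\<bar> =
      \<bar>\<Sum>i<n. integral {t i..t (Suc i)} \<phi> - \<phi> (m i) / real n\<bar>"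
    by (simp add: sum_subtractf sum_divide_distrib)
  also have "\<dots> \<le> (\<Sum>i<n. 2 * integral {0..c} \<omega>)"
    using cell by (intro order_trans[OF sum_abs] sum_mono) auto
  finally show ?thesis by (simp add: m_def c_def mult_ac)
qed

lemma infdist_finite_attained:
  fixes K :: "'a::heine_borel set"
  assumes "finite K" "K \<noteq> {}"
  obtains p where "p \<in> K" "infdist x K = dist x p"
  using infdist_attains_inf[of K x] assms by (auto simp: finite_imp_closed)

lemma continuous_on_modulus_infdist:
  assumes "modulus_of_continuity \<omega>"
  shows "continuous_on S (\<lambda>x. \<omega> (infdist x K))"
  by (intro continuous_on_compose2[OF modulus_of_continuityD(1)[OF assms]] continuous_intros)
    (auto simp: infdist_nonneg)

text \<open>
  The proof needs no decomposition of the interval into the cells of the knots. With \<open>c = 1/(2n)\<close>,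
  the function \<open>\<omega> (infdist x K)\<close> lies above \<open>\<omega> c\<close> minus the sum, over the knots \<open>p\<close>, of the bumps
  \<open>max 0 (\<omega> c - \<omega> \<bar>x - p\<bar>)\<close>. Each bump is supported in \<open>[p - c, p + c]\<close>, so its integral is at most
  \<open>2 (c * \<omega> c - integral {0..c} \<omega>)\<close>, and \<open>2 n c = 1\<close>.
\<close>

lemma integral_modulus_infdist_ge:
  fixes K :: "real set"
  assumes \<omega>: "modulus_of_continuity \<omega>" and K: "finite K" "K \<noteq> {}" "K \<subseteq> {0..1}" "card K \<le> n"
  shows "2 * real n * integral {0..1 / (2 * real n)} \<omega> \<le> integral {0..1} (\<lambda>x. \<omega> (infdist x K))"
proof -
  have n: "0 < n" using K card_gt_0_iff[of K] by simp
  define c where "c = 1 / (2 * real n)"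
  have c: "0 < c" "c \<le> 1" "2 * (real n * c) = 1" using n by (auto simp: c_def divide_simps)
  define \<phi> where "\<phi> s = max 0 (\<omega> c - \<omega> s)" for s
  define D where "D = c * \<omega> c - integral {0..c} \<omega>"
  note \<omega>_cont = modulus_of_continuityD(1)[OF \<omega>]
  note \<omega>_mono = modulus_of_continuityD(2)[OF \<omega>]
  have \<phi>_cont: "continuous_on {0..} \<phi>" unfolding \<phi>_def by (intro continuous_intros \<omega>_cont)
  have \<phi>_int: "\<phi> integrable_on {a..b}" if "0 \<le> a" for a b
    using that by (intro integrable_continuous_real continuous_on_subset[OF \<phi>_cont]) auto
  have \<omega>_int: "\<omega> integrable_on {0..c}"
    by (intro integrable_continuous_real continuous_on_subset[OF \<omega>_cont]) auto
  have "integral {0..1} \<phi> = integral {0..c} \<phi> + integral {c..1} \<phi>"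
    using c \<phi>_int by (intro Henstock_Kurzweil_Integration.integral_combine[symmetric]) auto
  also have "integral {0..c} \<phi> = integral {0..c} (\<lambda>s. \<omega> c - \<omega> s)"
    using \<omega>_mono by (intro integral_cong) (auto simp: \<phi>_def)
  also have "\<dots> = D"
    using c(1) \<omega>_int by (subst integral_diff) (auto simp: D_def)
  also have "integral {c..1} \<phi> = integral {c..1} (\<lambda>s. 0)"
    using \<omega>_mono c(1) by (intro integral_cong) (auto simp: \<phi>_def)
  finally have int_\<phi>: "integral {0..1} \<phi> = D" by simp
  have D: "integral {0..b} \<phi> \<le> D" if "b \<le> 1" for b
    unfolding int_\<phi>[symmetric] using that
    by (intro integral_subset_le \<phi>_int) (auto simp: \<phi>_def)
  have D0: "0 \<le> D" using D[of 0] by simp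
  have shifted_cont: "continuous_on {0..1} (\<lambda>x. \<phi> \<bar>x - p\<bar>)" for p
    by (intro continuous_on_compose2[OF \<phi>_cont] continuous_intros) auto
  have bump: "integral {0..1} (\<lambda>x. \<phi> \<bar>x - p\<bar>) \<le> 2 * D" if "p \<in> K" for p
  proof -
    have "0 \<le> p" "p \<le> 1" using that K(3) by auto
    then show ?thesis
      using integral_abs_shift[OF \<phi>_cont, of 0 p 1] D[of p] D[of "1 - p"] by simp
  qed
  have "integral {0..1} (\<lambda>x. \<omega> c - (\<Sum>p\<in>K. \<phi> \<bar>x - p\<bar>)) \<le> integral {0..1} (\<lambda>x. \<omega> (infdist x K))"
  proof (rule integral_le)
    show "(\<lambda>x. \<omega> c - (\<Sum>p\<in>K. \<phi> \<bar>x - p\<bar>)) integrable_on {0..1}"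
      by (intro integrable_continuous_real continuous_intros shifted_cont)
    show "(\<lambda>x. \<omega> (infdist x K)) integrable_on {0..1}"
      by (intro integrable_continuous_real continuous_on_modulus_infdist \<omega>)
    fix x
    obtain p where p: "p \<in> K" "infdist x K = dist x p"
      using infdist_finite_attained[OF K(1,2)] by blast
    have "\<phi> \<bar>x - p\<bar> \<le> (\<Sum>p\<in>K. \<phi> \<bar>x - p\<bar>)"
      using p(1) K(1) by (intro member_le_sum) (auto simp: \<phi>_def)
    then show "\<omega> c - (\<Sum>p\<in>K. \<phi> \<bar>x - p\<bar>) \<le> \<omega> (infdist x K)"
      using p(2) by (auto simp: \<phi>_def dist_real_def)
  qed
  moreover have "integral {0..1} (\<lambda>x. \<omega> c - (\<Sum>p\<in>K. \<phi> \<bar>x - p\<bar>)) =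
      \<omega> c - (\<Sum>p\<in>K. integral {0..1} (\<lambda>x. \<phi> \<bar>x - p\<bar>))"
  proof -
    have int: "(\<lambda>x. \<phi> \<bar>x - p\<bar>) integrable_on {0..1}" for p
      by (intro integrable_continuous_real shifted_cont)
    have "((\<lambda>x. \<omega> c - (\<Sum>p\<in>K. \<phi> \<bar>x - p\<bar>)) has_integral
        \<omega> c - (\<Sum>p\<in>K. integral {0..1} (\<lambda>x. \<phi> \<bar>x - p\<bar>))) {0..1}"
      using has_integral_const_real[of "\<omega> c" 0 1]
      by (intro has_integral_diff has_integral_sum K(1) integrable_integral int) simp
    then show ?thesis by (simp add: integral_unique)
  qed
  moreover have "(\<Sum>p\<in>K. integral {0..1} (\<lambda>x. \<phi> \<bar>x - p\<bar>)) \<le> real (card K) * (2 * D)"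
    using bump by (intro sum_bounded_above) auto
  moreover have "\<dots> \<le> real n * (2 * D)"
    using K(4) D0 by (intro mult_right_mono) auto
  moreover have "real n * (2 * D) = (2 * (real n * c)) * \<omega> c - 2 * real n * integral {0..c} \<omega>"
    by (simp add: D_def algebra_simps)
  ultimately show ?thesis using c(3) by (simp add: c_def)
qed

section \<open>The Riemann--Minkowski integral\<close>

lemma nonempty_compacts_bounded:
  fixes A :: "'a::euclidean_space set"
  assumes "A \<in> nonempty_compacts"
  obtains R where "\<And>a. a \<in> A \<Longrightarrow> norm a \<le> R"
proof -
  have "bounded A" using assms by (simp add: nonempty_compacts_def compact_imp_bounded)
  then show ?thesis using that unfolding bounded_iff by blast
qed

text \<open>
  A uniform limit \<open>p\<close>, on the unit ball, of support functions of compact sets is a support function.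
  The limit set is the intersection of the half-spaces prescribed by \<open>p\<close>. That \<open>p u\<close> is attained on it
  follows by compactness: points \<open>a k \<in> C k\<close> maximising \<open>u \<bullet> a\<close> accumulate at a point of the limit set.
\<close>

lemma support_fun_limit:
  fixes C :: "nat \<Rightarrow> 'a::euclidean_space set"
  assumes C: "\<And>k. C k \<in> nonempty_compacts" and e: "e \<longlonglongrightarrow> 0"
    and close: "\<And>k u. norm u \<le> 1 \<Longrightarrow> \<bar>support_fun (C k) u - p u\<bar> \<le> e k"
  obtains I where "I \<in> nonempty_compact_convex" "\<And>u. norm u \<le> 1 \<Longrightarrow> support_fun I u = p u"
proof -
  define I where "I = (\<Inter>u\<in>cball 0 1. {x. u \<bullet> x \<le> p u})"
  have I_iff: "x \<in> I \<longleftrightarrow> (\<forall>u. norm u \<le> 1 \<longrightarrow> u \<bullet> x \<le> p u)" for x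
    by (auto simp: I_def)
  obtain R where R: "\<And>a. a \<in> C 0 \<Longrightarrow> norm a \<le> R"
    using nonempty_compacts_bounded[OF C] by blast
  have p_le: "p u \<le> R + e 0" if "norm u \<le> 1" for u
  proof -
    obtain a where a: "a \<in> C 0" "support_fun (C 0) u = u \<bullet> a"
      using support_fun_attained[OF C] by blast
    have "u \<bullet> a \<le> norm u * norm a" by (rule norm_cauchy_schwarz)
    also have "\<dots> \<le> 1 * norm a" using that by (intro mult_right_mono) auto
    finally show ?thesis using close[OF that, of 0] a R[OF a(1)] by (simp add: abs_le_iff)
  qed
  have norm_le: "norm x \<le> M" if "\<And>u. norm u \<le> 1 \<Longrightarrow> u \<bullet> x \<le> M" for x :: 'a and M
    using that[of "x /\<^sub>R norm x"] that[of 0]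
    by (cases "x = 0") (auto simp: power2_norm_eq_inner[symmetric] power2_eq_square
        mult.assoc[symmetric])
  have "closed I" unfolding I_def by (intro closed_INT ballI closed_halfspace_le)
  moreover have "I \<subseteq> cball 0 (R + e 0)"
  proof
    fix x assume "x \<in> I"
    then have "u \<bullet> x \<le> R + e 0" if "norm u \<le> 1" for u
      using p_le[OF that] that by (force simp: I_iff)
    then show "x \<in> cball 0 (R + e 0)" using norm_le by simp
  qed
  ultimately have "compact I"
    using bounded_subset[OF bounded_cball] by (auto simp: compact_eq_bounded_closed)
  moreover have "convex I" unfolding I_def by (intro convex_INT convex_halfspace_le)
  moreover have attained: "\<exists>x\<in>I. u \<bullet> x = p u" if u: "norm u \<le> 1" for u
  proof -
    have "\<exists>a. a \<in> C k \<and> support_fun (C k) u = u \<bullet> a" for k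
      using support_fun_attained[OF C] by metis
    then obtain a where a: "\<And>k. a k \<in> C k" "\<And>k. support_fun (C k) u = u \<bullet> a k" by metis
    have le: "v \<bullet> a k \<le> p v + e k" if "norm v \<le> 1" for v k
      using support_fun_upper[OF C a(1)[of k], of v] close[OF that, of k] by (simp add: abs_le_iff)
    have "Bseq e" using e by (intro convergent_imp_Bseq convergentI)
    then obtain B where "\<And>k. norm (e k) \<le> B" unfolding Bseq_def by blast
    then have B: "e k \<le> B" for k by (metis abs_le_D1 real_norm_def)
    have "v \<bullet> a k \<le> R + e 0 + B" if "norm v \<le> 1" for v k
      using le[OF that, of k] p_le[OF that] B[of k] by simp
    then have "\<forall>k. a k \<in> cball 0 (R + e 0 + B)" by (auto intro: norm_le)
    then obtain x \<sigma> where \<sigma>: "strict_mono \<sigma>" "(a \<circ> \<sigma>) \<longlonglongrightarrow> x"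
      using compact_cball[of 0 "R + e 0 + B"] unfolding compact_def by meson
    have e\<sigma>: "(\<lambda>k. e (\<sigma> k)) \<longlonglongrightarrow> 0"
      using LIMSEQ_subseq_LIMSEQ[OF e \<sigma>(1)] by (simp add: o_def)
    have lim: "(\<lambda>k. v \<bullet> a (\<sigma> k)) \<longlonglongrightarrow> v \<bullet> x" for v
      using \<sigma>(2) by (auto intro!: tendsto_intros simp: o_def)
    have "v \<bullet> x \<le> p v" if "norm v \<le> 1" for v
    proof (rule LIMSEQ_le[OF lim])
      show "(\<lambda>k. p v + e (\<sigma> k)) \<longlonglongrightarrow> p v"
        using tendsto_add[OF tendsto_const e\<sigma>, of "p v"] by simp
    qed (use le[OF that] in auto)
    moreover have "p u \<le> u \<bullet> x"
    proof (rule LIMSEQ_le[OF _ lim])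
      show "(\<lambda>k. p u - e (\<sigma> k)) \<longlonglongrightarrow> p u"
        using tendsto_diff[OF tendsto_const e\<sigma>, of "p u"] by simp
      have "p u - e k \<le> u \<bullet> a k" for k
        using close[OF u, of k] a(2)[of k] by (simp add: abs_le_iff)
      then show "\<exists>N. \<forall>k\<ge>N. p u - e (\<sigma> k) \<le> u \<bullet> a (\<sigma> k)" by blast
    qed
    ultimately show ?thesis using u by (intro bexI[of _ x]) (auto simp: I_iff intro: antisym)
  qed
  ultimately have "I \<in> nonempty_compact_convex"
    using attained[of 0] by (auto simp: nonempty_compact_convex_def nonempty_compacts_def)
  moreover have "support_fun I u = p u" if u: "norm u \<le> 1" for u
  proof -
    obtain x where "x \<in> I" "u \<bullet> x = p u" using attained[OF u] by blast
    then show ?thesis using u by (intro support_fun_eqI) (auto simp: I_iff)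
  qed
  ultimately show ?thesis using that by blast
qed

lemma riemann_minkowski_sum_nonempty_compacts:
  assumes "f \<in> {0..1} \<rightarrow> nonempty_compacts" "tagged_partition01 N t \<xi>"
  shows "riemann_minkowski_sum f N t \<xi> \<in> nonempty_compacts"
  unfolding riemann_minkowski_sum_def using tagged_partition01D(5)[OF assms(2)]
  by (intro nonempty_compacts_sum nonempty_compacts_scaleR Pi_mem[OF assms(1)]) auto

lemma has_rm_integral_unique:
  assumes I: "has_rm_integral g I" and J: "has_rm_integral g J"
    and g: "g \<in> {0..1} \<rightarrow> nonempty_compacts"
  shows "I = J"
proof -
  have IJ: "I \<in> nonempty_compacts" "J \<in> nonempty_compacts"
    using I J by (auto simp: has_rm_integral_def)
  have "hausdorff_dist I J \<le> 0 + e" if "0 < e" for e :: real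
  proof -
    have e: "0 < e / 2" using that by simp
    obtain d1 where d1: "0 < d1" "\<forall>N t \<xi>. tagged_partition01 N t \<xi> \<and> partition_mesh N t < d1 \<longrightarrow>
        hausdorff_dist (riemann_minkowski_sum g N t \<xi>) I < e / 2"
      using I e unfolding has_rm_integral_def by blast
    obtain d2 where d2: "0 < d2" "\<forall>N t \<xi>. tagged_partition01 N t \<xi> \<and> partition_mesh N t < d2 \<longrightarrow>
        hausdorff_dist (riemann_minkowski_sum g N t \<xi>) J < e / 2"
      using J e unfolding has_rm_integral_def by blast
    obtain k where "inverse (real (Suc k)) < min d1 d2"
      using reals_Archimedean[of "min d1 d2"] d1(1) d2(1) by auto
    then have k: "1 / real (Suc k) < d1" "1 / real (Suc k) < d2"
      by (simp_all add: inverse_eq_divide)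
    define t where "t i = real i / real (Suc k)" for i :: nat
    have P: "tagged_partition01 (Suc k) t t" "partition_mesh (Suc k) t = 1 / real (Suc k)"
      using uniform_partition[of "Suc k"] by (simp_all add: t_def[abs_def])
    have S: "riemann_minkowski_sum g (Suc k) t t \<in> nonempty_compacts"
      using g P(1) by (rule riemann_minkowski_sum_nonempty_compacts)
    have "hausdorff_dist (riemann_minkowski_sum g (Suc k) t t) I < e / 2"
      "hausdorff_dist (riemann_minkowski_sum g (Suc k) t t) J < e / 2"
      using d1(2) d2(2) P k by simp_all
    then show ?thesis
      using hausdorff_dist_triangle[OF IJ(1) S IJ(2)]
      unfolding hausdorff_dist_commute[of I] by linarith
  qed
  then have "hausdorff_dist I J \<le> 0" by (rule field_le_epsilon)
  then show ?thesis
    using hausdorff_dist_nonneg[OF IJ] hausdorff_dist_eq_0_imp_eq[OF IJ] by simp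
qed

lemma rm_integral_eqI:
  assumes "has_rm_integral g I" "g \<in> {0..1} \<rightarrow> nonempty_compacts"
  shows "rm_integral g = I"
  unfolding rm_integral_def
  using assms(1) by (rule the_equality) (rule has_rm_integral_unique[OF _ assms])

lemma H_classD:
  assumes "f \<in> H_class \<omega>"
  shows "\<And>x. x \<in> {0..1} \<Longrightarrow> f x \<in> nonempty_compacts"
    "\<And>x y. x \<in> {0..1} \<Longrightarrow> y \<in> {0..1} \<Longrightarrow> hausdorff_dist (f x) (f y) \<le> \<omega> \<bar>x - y\<bar>"
  using assms by (auto simp: H_class_def)

lemma H_class_Pi: "f \<in> H_class \<omega> \<Longrightarrow> f \<in> {0..1} \<rightarrow> nonempty_compacts"
  by (auto simp: H_class_def)

lemma H_class_support_fun:
  assumes "f \<in> H_class \<omega>" "norm u \<le> 1" "x \<in> {0..1}" "y \<in> {0..1}"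
  shows "\<bar>support_fun (f x) u - support_fun (f y) u\<bar> \<le> \<omega> \<bar>x - y\<bar>"
  using abs_support_fun_diff_le[OF H_classD(1)[OF assms(1,3)] H_classD(1)[OF assms(1,4)] assms(2)]
    H_classD(2)[OF assms(1,3,4)] by simp

lemma H_class_bounded:
  fixes f :: "real \<Rightarrow> 'a::euclidean_space set"
  assumes \<omega>: "modulus_of_continuity \<omega>" and f: "f \<in> H_class \<omega>"
  obtains R where "0 \<le> R" "\<forall>x\<in>{0..1}. \<forall>a\<in>f x. norm a \<le> R"
proof -
  have f0: "f 0 \<in> nonempty_compacts" using H_classD(1)[OF f, of 0] by simp
  then obtain R0 where R0: "\<And>a. a \<in> f 0 \<Longrightarrow> norm a \<le> R0"
    using nonempty_compacts_bounded by blast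
  have "norm a \<le> R0 + \<omega> 1" if x: "x \<in> {0..1}" and a: "a \<in> f x" for x a
  proof -
    obtain b where b: "b \<in> f 0" "dist a b \<le> hausdorff_dist (f x) (f 0)"
      using hausdorff_distD[OF H_classD(1)[OF f x] f0 a] by blast
    have "hausdorff_dist (f x) (f 0) \<le> \<omega> \<bar>x - 0\<bar>" by (rule H_classD(2)[OF f x]) simp
    also have "\<dots> \<le> \<omega> 1" using x by (intro modulus_of_continuityD(2)[OF \<omega>]) auto
    finally have "norm (a - b) \<le> \<omega> 1" using b(2) by (simp add: dist_norm)
    then show ?thesis using R0[OF b(1)] norm_triangle_sub[of a b] by simp
  qed
  then have "\<forall>x\<in>{0..1}. \<forall>a\<in>f x. norm a \<le> max 0 (R0 + \<omega> 1)"
    by (simp add: le_max_iff_disj)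
  then show ?thesis using that[of "max 0 (R0 + \<omega> 1)"] by simp
qed

lemma support_fun_riemann_minkowski_sum:
  assumes "f \<in> {0..1} \<rightarrow> nonempty_compacts" "tagged_partition01 N t \<xi>"
  shows "support_fun (riemann_minkowski_sum f N t \<xi>) u =
    (\<Sum>i<N. (t (Suc i) - t i) * support_fun (f (\<xi> i)) u)"
proof -
  have *: "f (\<xi> i) \<in> nonempty_compacts" "0 \<le> t (Suc i) - t i" if "i < N" for i
    using assms(1) tagged_partition01D[OF assms(2) that] by auto
  show ?thesis
    unfolding riemann_minkowski_sum_def
    by (subst support_fun_sum) (simp_all add: nonempty_compacts_scaleR support_fun_scaleR * del: diff_ge_0_iff_ge)
qed

text \<open>
  The values of \<open>f\<close> are scaled by the lengths \<open>d\<close> of the partition intervals, so the sum of squared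
  diameters is at most \<open>(2 * R)\<^sup>2\<close> times the sum of all \<open>d\<^sup>2\<close>, which in turn is at most the mesh since the
  lengths add up to one.
\<close>

lemma riemann_minkowski_sum_near_hull:
  fixes f :: "real \<Rightarrow> 'a::euclidean_space set"
  assumes f: "f \<in> {0..1} \<rightarrow> nonempty_compacts" and P: "tagged_partition01 N t \<xi>"
    and R: "0 \<le> R" "\<forall>x\<in>{0..1}. \<forall>a\<in>f x. norm a \<le> R"
  shows "hausdorff_dist (riemann_minkowski_sum f N t \<xi>) (convex hull (riemann_minkowski_sum f N t \<xi>))
    \<le> 2 * R * sqrt (partition_mesh N t)"
proof -
  let ?d = "\<lambda>i. t (Suc i) - t i"
  let ?m = "partition_mesh N t"
  have "hausdorff_dist (riemann_minkowski_sum f N t \<xi>) (convex hull (riemann_minkowski_sum f N t \<xi>))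
      \<le> sqrt (\<Sum>i<N. (2 * (?d i * R))\<^sup>2)"
    unfolding riemann_minkowski_sum_def
  proof (rule hausdorff_dist_sum_hull)
    fix i assume i: "i < N"
    note ti = tagged_partition01D[OF P i]
    show "(*\<^sub>R) (?d i) ` f (\<xi> i) \<in> nonempty_compacts"
      using f ti(5) by (intro nonempty_compacts_scaleR Pi_mem[OF f])
    show "norm a \<le> ?d i * R" if "a \<in> (*\<^sub>R) (?d i) ` f (\<xi> i)" for a
      using that bspec[OF R(2) ti(5)] ti(2) by (auto intro!: mult_left_mono)
  qed
  also have "(\<Sum>i<N. (2 * (?d i * R))\<^sup>2) \<le> (\<Sum>i<N. (2 * R)\<^sup>2 * ?m * ?d i)"
  proof (rule sum_mono)
    fix i assume "i \<in> {..<N}"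
    then have "?d i \<le> ?m" "0 \<le> ?d i" using tagged_partition01D(2,6)[OF P, of i] by auto
    then have "(2 * R)\<^sup>2 * (?d i * ?d i) \<le> (2 * R)\<^sup>2 * (?m * ?d i)"
      by (intro mult_left_mono mult_right_mono) auto
    moreover have "(2 * (?d i * R))\<^sup>2 = (2 * R)\<^sup>2 * (?d i * ?d i)"
      by (simp only: power2_eq_square mult_ac)
    ultimately show "(2 * (?d i * R))\<^sup>2 \<le> (2 * R)\<^sup>2 * ?m * ?d i"
      by (simp only: mult.assoc)
  qed
  also have "\<dots> = (2 * R)\<^sup>2 * ?m"
    by (simp add: sum_distrib_left[symmetric] tagged_partition01_sum[OF P])
  also have "sqrt \<dots> = 2 * R * sqrt ?m"
    using R(1) by (simp add: real_sqrt_mult)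
  finally show ?thesis by simp
qed

text \<open>
  The candidate for the integral is the set whose support function is the limit along uniform
  partitions; an arbitrary Riemann--Minkowski sum is compared with it through its convex hull.
\<close>

lemma H_class_has_rm_integral:
  fixes f :: "real \<Rightarrow> 'a::euclidean_space set"
  assumes \<omega>: "modulus_of_continuity \<omega>" and f: "f \<in> H_class \<omega>"
  obtains I where "has_rm_integral f I" "I \<in> nonempty_compact_convex"
    "\<And>u. norm u \<le> 1 \<Longrightarrow> support_fun I u = integral {0..1} (\<lambda>x. support_fun (f x) u)"
proof -
  define p where "p u = integral {0..1} (\<lambda>x. support_fun (f x) u)" for u
  note fc = H_class_Pi[OF f]
  have close: "\<bar>support_fun (riemann_minkowski_sum f N t \<xi>) u - p u\<bar> \<le> \<omega> (partition_mesh N t)"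
    if P: "tagged_partition01 N t \<xi>" and u: "norm u \<le> 1" for N t \<xi> u
    unfolding p_def support_fun_riemann_minkowski_sum[OF fc P]
  proof (rule riemann_sum_error[OF P, where \<phi> = "\<lambda>x. support_fun (f x) u"])
    show "continuous_on {0..1} (\<lambda>x. support_fun (f x) u)"
      by (rule modulus_bounded_imp_continuous[OF \<omega> H_class_support_fun[OF f u]])
    show "\<bar>support_fun (f x) u - support_fun (f y) u\<bar> \<le> \<omega> (partition_mesh N t)"
      if "x \<in> {0..1}" "y \<in> {0..1}" "\<bar>x - y\<bar> \<le> partition_mesh N t" for x y
      using H_class_support_fun[OF f u that(1,2)] modulus_of_continuityD(2)[OF \<omega> _ that(3)] by simp
  qed
  define t where "t k i = real i / real (Suc k)" for k i :: nat
  have P: "tagged_partition01 (Suc k) (t k) (t k)" "partition_mesh (Suc k) (t k) = 1 / real (Suc k)" for k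
    using uniform_partition[of "Suc k"] by (simp_all add: t_def[abs_def])
  have "(\<lambda>k. \<omega> (1 / real (Suc k))) \<longlonglongrightarrow> \<omega> 0"
  proof (rule continuous_on_tendsto_compose[OF modulus_of_continuityD(1)[OF \<omega>]])
    show "(\<lambda>k. 1 / real (Suc k)) \<longlonglongrightarrow> 0"
      using LIMSEQ_inverse_real_of_nat by (simp add: inverse_eq_divide)
  qed auto
  then have lim: "(\<lambda>k. \<omega> (1 / real (Suc k))) \<longlonglongrightarrow> 0"
    by (simp add: modulus_of_continuityD(4)[OF \<omega>])
  define C where "C k = riemann_minkowski_sum f (Suc k) (t k) (t k)" for k
  have "C k \<in> nonempty_compacts" for k
    unfolding C_def by (rule riemann_minkowski_sum_nonempty_compacts[OF fc P(1)])
  moreover have "\<bar>support_fun (C k) u - p u\<bar> \<le> \<omega> (1 / real (Suc k))" if "norm u \<le> 1" for k u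
    using close[OF P(1) that, of k] unfolding P(2) C_def .
  ultimately obtain I where I: "I \<in> nonempty_compact_convex" "\<And>u. norm u \<le> 1 \<Longrightarrow> support_fun I u = p u"
    using support_fun_limit[of C _ p, OF _ lim] by blast
  have I': "I \<in> nonempty_compacts" using I(1) by (simp add: nonempty_compact_convex_def)
  obtain R where R: "0 \<le> R" "\<forall>x\<in>{0..1}. \<forall>a\<in>f x. norm a \<le> R"
    using H_class_bounded[OF \<omega> f] by blast
  have "\<exists>d>0. \<forall>N t \<xi>. tagged_partition01 N t \<xi> \<and> partition_mesh N t < d \<longrightarrow>
      hausdorff_dist (riemann_minkowski_sum f N t \<xi>) I < e" if e: "0 < e" for e
  proof -
    obtain d where d: "0 < d" "\<And>s. 0 \<le> s \<Longrightarrow> s < d \<Longrightarrow> \<omega> s < e / 2"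
      using modulus_of_continuity_tendsto_0[OF \<omega>, of "e / 2"] e by auto
    \<comment> \<open>\<open>R + 1\<close> rather than \<open>R\<close>, since \<open>R\<close> may be zero.\<close>
    define d' where "d' = (e / (4 * (R + 1)))\<^sup>2"
    have d': "0 < d'" "sqrt d' = e / (4 * (R + 1))" using e R(1) by (auto simp: d'_def)
    have "hausdorff_dist (riemann_minkowski_sum f N t \<xi>) I < e"
      if P: "tagged_partition01 N t \<xi>" and m: "partition_mesh N t < min d d'" for N t \<xi>
    proof -
      let ?S = "riemann_minkowski_sum f N t \<xi>"
      have S: "?S \<in> nonempty_compacts" using riemann_minkowski_sum_nonempty_compacts[OF fc P] .
      have "hausdorff_dist ?S (convex hull ?S) \<le> 2 * R * sqrt (partition_mesh N t)"
        using riemann_minkowski_sum_near_hull[OF fc P R] .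
      also have "\<dots> \<le> 2 * R * sqrt d'"
        using m R(1) by (intro mult_left_mono) auto
      also have "\<dots> \<le> e / 2" using e R(1) by (simp add: d'(2) divide_simps mult_ac)
      finally have 1: "hausdorff_dist ?S (convex hull ?S) \<le> e / 2" .
      have "hausdorff_dist (convex hull ?S) I \<le> \<omega> (partition_mesh N t)"
        using nonempty_compacts_hull[OF S] I close[OF P]
        by (intro hausdorff_dist_le_support_fun)
          (auto simp: nonempty_compact_convex_def support_fun_hull[OF S])
      also have "\<dots> < e / 2" using partition_mesh_pos[OF P] m by (intro d) auto
      finally show ?thesis
        using 1 hausdorff_dist_triangle[OF S nonempty_compacts_hull[OF S] I'] by linarith
    qed
    then show ?thesis using d(1) d'(1) by (intro exI[of _ "min d d'"]) auto
  qed
  then have "has_rm_integral f I" unfolding has_rm_integral_def using I' by blast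
  then show ?thesis using that I by (simp add: p_def)
qed

lemma H_class_rm_integral:
  fixes f :: "real \<Rightarrow> 'a::euclidean_space set"
  assumes \<omega>: "modulus_of_continuity \<omega>" and f: "f \<in> H_class \<omega>"
  shows "rm_integral f \<in> nonempty_compact_convex"
    and "norm u \<le> 1 \<Longrightarrow> support_fun (rm_integral f) u = integral {0..1} (\<lambda>x. support_fun (f x) u)"
proof -
  obtain I where I: "has_rm_integral f I" "I \<in> nonempty_compact_convex"
    "\<And>u. norm u \<le> 1 \<Longrightarrow> support_fun I u = integral {0..1} (\<lambda>x. support_fun (f x) u)"
    using H_class_has_rm_integral[OF \<omega> f] by blast
  have "rm_integral f = I" using I(1) H_class_Pi[OF f] by (rule rm_integral_eqI)
  with I show "rm_integral f \<in> nonempty_compact_convex"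
    "norm u \<le> 1 \<Longrightarrow> support_fun (rm_integral f) u = integral {0..1} (\<lambda>x. support_fun (f x) u)"
    by simp_all
qed

section \<open>The error of the hull of the mean\<close>

lemma midpoint_knots_in_knot_lists:
  assumes "1 \<le> n"
  shows "midpoint_knots n \<in> knot_lists n"
proof -
  have "sorted_wrt (<) (map (\<lambda>i. (2 * real i - 1) / (2 * real n)) [1..<n + 1])"
    using assms unfolding sorted_wrt_map
    by (intro sorted_wrt_mono_rel[OF _ sorted_wrt_upt]) (auto simp: divide_strict_right_mono)
  then show ?thesis
    using assms by (auto simp: knot_lists_def midpoint_knots_def divide_simps)
qed

lemma mean_nonempty_compacts:
  fixes As :: "'a::euclidean_space set list"
  assumes "length As = n" "set As \<subseteq> nonempty_compacts"
  shows "(*\<^sub>R) (1 / real n) ` (\<Sum>i<n. As ! i) \<in> nonempty_compacts"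
  using assms by (intro nonempty_compacts_scaleR nonempty_compacts_sum) auto

lemma hull_mean_in_recovery_methods:
  "hull_mean n \<in> (recovery_methods n :: ('a::euclidean_space set list \<Rightarrow> 'a set) set)"
  by (auto simp: recovery_methods_def hull_mean_def nonempty_compact_convex_def
      intro!: nonempty_compacts_hull mean_nonempty_compacts)

lemma support_fun_hull_mean:
  fixes As :: "'a::euclidean_space set list"
  assumes "length As = n" "set As \<subseteq> nonempty_compacts"
  shows "support_fun (hull_mean n As) u = (\<Sum>i<n. support_fun (As ! i) u) / real n"
proof -
  have As: "As ! i \<in> nonempty_compacts" if "i < n" for i using assms that by auto
  then show ?thesis
    unfolding hull_mean_def support_fun_hull[OF mean_nonempty_compacts[OF assms]]
    by (subst support_fun_scaleR; (subst support_fun_sum)?) (auto intro!: nonempty_compacts_sum)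
qed

lemma hull_mean_error:
  fixes f :: "real \<Rightarrow> 'a::euclidean_space set"
  assumes \<omega>: "modulus_of_continuity \<omega>" and n: "1 \<le> n" and f: "f \<in> H_class \<omega>"
  shows "hausdorff_dist (rm_integral f) (hull_mean n (map f (midpoint_knots n)))
    \<le> 2 * real n * integral {0..1 / (2 * real n)} \<omega>"
proof (rule hausdorff_dist_le_support_fun)
  let ?As = "map f (midpoint_knots n)"
  have As: "length ?As = n" "set ?As \<subseteq> nonempty_compacts"
    using midpoint_knots_in_knot_lists[OF n] H_classD(1)[OF f]
    by (auto simp: knot_lists_def)
  show "rm_integral f \<in> nonempty_compact_convex" using H_class_rm_integral(1)[OF \<omega> f] .
  show "hull_mean n ?As \<in> nonempty_compact_convex"
    using hull_mean_in_recovery_methods As unfolding recovery_methods_def by blast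
  fix u :: 'a assume u: "norm u \<le> 1"
  \<comment> \<open>The list of knots is indexed from zero, hence \<open>2 * i + 1\<close> instead of \<open>2 * i - 1\<close>.\<close>
  have nth: "?As ! i = f ((2 * real i + 1) / (2 * real n))" if "i < n" for i
    using that by (simp add: midpoint_knots_def add.commute del: upt_Suc)
  show "\<bar>support_fun (rm_integral f) u - support_fun (hull_mean n ?As) u\<bar>
      \<le> 2 * real n * integral {0..1 / (2 * real n)} \<omega>"
    using midpoint_rule_error[of \<omega> n "\<lambda>x. support_fun (f x) u", OF \<omega>] H_class_support_fun[OF f u] n
    by (simp add: H_class_rm_integral(2)[OF \<omega> f u] support_fun_hull_mean[OF As] nth)
qed

section \<open>Functions that no method can distinguish\<close>

text \<open>
  For singleton-valued functions whose points lie on a fixed line through the origin, the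
  set-valued integral reduces to the scalar one.
\<close>

lemma rm_integral_singletons:
  fixes e :: "'a::euclidean_space"
  assumes \<omega>: "modulus_of_continuity \<omega>" and e: "norm e = 1"
    and g: "\<And>x y. x \<in> {0..1} \<Longrightarrow> y \<in> {0..1} \<Longrightarrow> \<bar>g x - g y\<bar> \<le> \<omega> \<bar>x - y\<bar>"
  shows "(\<lambda>x. {g x *\<^sub>R e}) \<in> H_class \<omega>"
    and "rm_integral (\<lambda>x. {g x *\<^sub>R e}) = {integral {0..1} g *\<^sub>R e}"
proof -
  let ?f = "\<lambda>x. {g x *\<^sub>R e}"
  have "dist (g x *\<^sub>R e) (g y *\<^sub>R e) = \<bar>g x - g y\<bar>" for x y
    using e by (simp only: dist_norm scaleR_diff_left[symmetric] norm_scaleR mult_1_right)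
  then show f: "?f \<in> H_class \<omega>"
    using g by (simp add: H_class_def nonempty_compacts_def hausdorff_dist_singletons e)
  have supp: "support_fun {a} u = u \<bullet> a" for a u :: 'a by (simp add: support_fun_def)
  let ?I = "{integral {0..1} g *\<^sub>R e}"
  have I: "?I \<in> nonempty_compact_convex"
    by (simp add: nonempty_compact_convex_def nonempty_compacts_def)
  note J = H_class_rm_integral[OF \<omega> f]
  have "hausdorff_dist (rm_integral ?f) ?I \<le> 0"
    using J(2) by (intro hausdorff_dist_le_support_fun J(1) I) (simp add: supp)
  moreover have "?I \<in> nonempty_compacts" "rm_integral ?f \<in> nonempty_compacts"
    using I J(1) by (auto simp: nonempty_compact_convex_def)
  ultimately show "rm_integral ?f = ?I"
    using hausdorff_dist_nonneg hausdorff_dist_eq_0_imp_eq by (metis order_antisym)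
qed

lemma method_error_ge:
  fixes \<Phi> :: "'a::euclidean_space set list \<Rightarrow> 'a set"
  assumes \<omega>: "modulus_of_continuity \<omega>" and n: "1 \<le> n" and xs: "xs \<in> knot_lists n"
    and \<Phi>: "\<Phi> \<in> recovery_methods n"
  shows "ereal (2 * real n * integral {0..1 / (2 * real n)} \<omega>) \<le> method_error (H_class \<omega>) xs \<Phi>"
proof -
  obtain e :: 'a where e: "norm e = 1" using vector_choose_size[of 1] by auto
  define K where "K = set xs"
  have K: "finite K" "K \<noteq> {}" "K \<subseteq> {0..1}" "card K \<le> n"
    using xs n card_length[of xs] by (auto simp: K_def knot_lists_def)
  define g where "g x = \<omega> (infdist x K)" for x
  define W where "W = integral {0..1} g"
  have W: "2 * real n * integral {0..1 / (2 * real n)} \<omega> \<le> W"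
    using integral_modulus_infdist_ge[OF \<omega> K] by (simp add: W_def g_def[abs_def])
  have g: "\<bar>g x - g y\<bar> \<le> \<omega> \<bar>x - y\<bar>" for x y
    unfolding g_def using infdist_triangle_abs[of x K y]
    by (intro modulus_abs_diff[OF \<omega>]) (auto simp: infdist_nonneg dist_real_def)
  have g0: "g x = 0" if "x \<in> K" for x
    using that by (simp add: g_def modulus_of_continuityD(4)[OF \<omega>])
  \<comment> \<open>For \<open>s = 1\<close> and \<open>s = - 1\<close> these functions vanish at the knots and hence cannot be told apart.\<close>
  define f where "f s x = {(s * g x) *\<^sub>R e}" for s x
  have f: "f s \<in> H_class \<omega>" "rm_integral (f s) = {(s * W) *\<^sub>R e}" if "\<bar>s\<bar> = 1" for s
  proof -
    have "\<bar>s * g x - s * g y\<bar> \<le> \<omega> \<bar>x - y\<bar>" for x y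
      using g[of x y] that by (simp add: abs_mult flip: right_diff_distrib)
    from rm_integral_singletons[OF \<omega> e this]
    show "f s \<in> H_class \<omega>" "rm_integral (f s) = {(s * W) *\<^sub>R e}"
      by (simp_all add: f_def[abs_def] W_def)
  qed
  define C where "C = \<Phi> (map (\<lambda>x. {0}) xs)"
  have info: "map (f s) xs = map (\<lambda>x. {0}) xs" for s
    using g0 by (auto simp: f_def K_def)
  have err: "ereal (hausdorff_dist {(s * W) *\<^sub>R e} C) \<le> method_error (H_class \<omega>) xs \<Phi>"
    if "\<bar>s\<bar> = 1" for s
    unfolding method_error_def C_def info[of s, symmetric] f(2)[OF that, symmetric]
    by (rule SUP_upper[OF f(1)[OF that]])
  have "map (\<lambda>x. {0}) xs \<in> {As :: 'a set list. length As = n \<and> set As \<subseteq> nonempty_compacts}"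
    using xs by (auto simp: knot_lists_def nonempty_compacts_def)
  then have "C \<in> nonempty_compact_convex" using \<Phi> unfolding C_def recovery_methods_def by blast
  then have C: "C \<in> nonempty_compacts" by (simp add: nonempty_compact_convex_def)
  have single: "{a} \<in> nonempty_compacts" for a :: 'a by (simp add: nonempty_compacts_def)
  have "dist (W *\<^sub>R e) (- W *\<^sub>R e) = \<bar>2 * W\<bar>"
    using e by (simp only: dist_norm scaleR_diff_left[symmetric] norm_scaleR mult_1_right)
  then have "2 * W \<le> hausdorff_dist {(1 * W) *\<^sub>R e} C + hausdorff_dist {(- 1 * W) *\<^sub>R e} C"
    using hausdorff_dist_triangle[OF single C single, of "W *\<^sub>R e" "- W *\<^sub>R e"]
    by (simp add: hausdorff_dist_singletons hausdorff_dist_commute[of C])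
  then have "W \<le> hausdorff_dist {(1 * W) *\<^sub>R e} C \<or> W \<le> hausdorff_dist {(- 1 * W) *\<^sub>R e} C"
    by linarith
  then have "\<exists>s. \<bar>s\<bar> = 1 \<and> W \<le> hausdorff_dist {(s * W) *\<^sub>R e} C"
    using exI[of _ "1::real"] exI[of _ "- 1::real"] by (metis abs_minus_cancel abs_one)
  then obtain s :: real where s: "\<bar>s\<bar> = 1" "W \<le> hausdorff_dist {(s * W) *\<^sub>R e} C" by blast
  have "ereal (2 * real n * integral {0..1 / (2 * real n)} \<omega>) \<le> ereal (hausdorff_dist {(s * W) *\<^sub>R e} C)"
    using W s(2) by simp
  also note err[OF s(1)]
  finally show ?thesis .
qed

section \<open>The optimal recovery error\<close>

theorem theorem2:
  fixes \<omega> :: "real \<Rightarrow> real" and n :: nat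
    and H :: "(real \<Rightarrow> (real ^ 'm) set) set"
  assumes "modulus_of_continuity \<omega>" and "n \<ge> 1"
  assumes H_eq: "H = H_class \<omega>"
  shows "optimal_error H n = ereal (2 * real n * integral {0..1 / (2 * real n)} \<omega>)
    \<and> midpoint_knots n \<in> knot_lists n
    \<and> knots_error H (midpoint_knots n) = optimal_error H n
    \<and> hull_mean n \<in> (recovery_methods n :: ((real ^ 'm) set list \<Rightarrow> (real ^ 'm) set) set)
    \<and> method_error H (midpoint_knots n) (hull_mean n) = knots_error H (midpoint_knots n)"
proof -
  define E where "E = ereal (2 * real n * integral {0..1 / (2 * real n)} \<omega>)"
  note knots = midpoint_knots_in_knot_lists[OF assms(2)]
  have hm: "hull_mean n \<in> (recovery_methods n :: ((real ^ 'm) set list \<Rightarrow> (real ^ 'm) set) set)"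
    by (rule hull_mean_in_recovery_methods)
  have len: "length xs = n" if "xs \<in> knot_lists n" for xs
    using that by (simp add: knot_lists_def)
  have lower: "E \<le> knots_error H xs" if "xs \<in> knot_lists n" for xs
    unfolding knots_error_def len[OF that] E_def H_eq
    using method_error_ge[OF assms(1,2) that] by (intro INF_greatest)
  have upper: "method_error H (midpoint_knots n) (hull_mean n) \<le> E"
    unfolding method_error_def E_def H_eq
    using hull_mean_error[OF assms(1,2)] by (intro SUP_least) simp
  have "knots_error H (midpoint_knots n) \<le> method_error H (midpoint_knots n) (hull_mean n)"
    unfolding knots_error_def len[OF knots] using hm by (rule INF_lower)
  with upper lower[OF knots]
  have eq: "method_error H (midpoint_knots n) (hull_mean n) = E" "knots_error H (midpoint_knots n) = E"
    by simp_all
  have "optimal_error H n = E"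
  proof (rule antisym)
    show "optimal_error H n \<le> E"
      unfolding optimal_error_def eq(2)[symmetric] using knots by (rule INF_lower)
    show "E \<le> optimal_error H n"
      unfolding optimal_error_def using lower by (intro INF_greatest)
  qed
  with eq knots hm show ?thesis by (simp add: E_def)
qed

end
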